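(* Let $A\in M_n(\mathbb{C})$, let $\lambda$ be an eigenvalue of $A$ with a Jordan block $J_r(\lambda)$ of size $r$, and let $x_1,\dots,x_r$ be a Jordan chain of $A$ for this block. Let $1\le m\le r$ be an integer and $b\in\mathbb{C}^n$ an arbitrary vector. Suppose that, in place of this block, $\lambda$ has a Jordan block of size $\tilde r$ for the matrix $A+x_mb^*$. Let $t\ge 1$ be an integer with $t\le\tilde r$ and $m+t\le r$. Assume $1+b^*x_{m+1}\neq 0$ and, if $t\ge2$, also $b^*x_1\ne 0$. Put $$\beta=\frac{-b^*x_1}{1+b^*x_{m+1}} .$$ Then $A+x_mb^*$ has a generalized eigenvector $u_t$ of rank $t$ associated with $\lambda$, given as follows. (1) When $t\le m+1$, $$u_t=x_t+\sum_{j=1}^{t-1}\beta_j^{(t)}x_j+\beta x_{m+t},$$ where the coefficients satisfy the recurrence $$\beta_{j+1}^{(t)}=\beta_j^{(t-1)},\qquad 1\le j\le t-2,$$ and $$\beta_1^{(t)}=\frac{-b^*x_t-\sum_{j=2}^{t-1}\beta_{j-1}^{(t-1)}(b^*x_j)-\beta\, b^*x_{m+t}}{b^*x_1},\qquad t\ge2 .$$ (2) When $t>m+1$, $$u_t=x_t+\sum_{j=1}^{m}\beta_j^{(t)}x_j+\beta x_{m+t},$$ where $\beta_{j+1}^{(t)}=\beta_j^{(t-1)}$ for $1\le j\le m-1$, and $$\beta_1^{(t)}=\frac{\beta_m^{(t-1)}-b^*x_t-\sum_{j=2}^{m}\beta_{j-1}^{(t-1)}(b^*x_j)-\beta\, 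b^*x_{m+t}}{b^*x_1}.$$
   Context: $b^*$ denotes the conjugate transpose of $b$. A vector $x$ is a generalized eigenvector of rank $k$ of a matrix $M$ for the eigenvalue $\lambda$ if $(M-\lambda I)^k x=0$ and $(M-\lambda I)^{k-1}x\neq0$. The Jordan chain $x_1,\dots,x_r$ consists of vectors $x_j$, where $x_j$ is a generalized eigenvector of $A$ of rank $j$, with $Ax_j=\lambda x_j+x_{j-1}$ for $1\le j\le r$, where $x_0=0$. The scalars $\beta_j^{(t)}$ are defined recursively in $t$ (for levels $1,2,\dots,t$, each level using the formulas of case (1) or (2) according to its value); empty sums are $0$, and any scalar or vector with a subscript or superscript $0$ is $0$. *)

theory Defs
  imports "Jordan_Normal_Form.Jordan_Normal_Form"
begin

definition hprod :: "complex vec \<Rightarrow> complex vec \<Rightarrow> complex" where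
  "hprod b x = conjugate b \<bullet> x"  (* the scalar b^* x *)

definition outer_hprod :: "complex vec \<Rightarrow> complex vec \<Rightarrow> complex mat" where
  "outer_hprod x b =
     mat_of_cols (dim_vec x) [x] * mat_of_rows (dim_vec b) [conjugate b]"  (* the matrix x b^* *)

(* char_matrix M lam is M - lam I.  For k = 0 the predicate is false, since k - 1 = 0 on nat. *)
definition gen_eigenvector :: "complex mat \<Rightarrow> complex \<Rightarrow> nat \<Rightarrow> complex vec \<Rightarrow> bool" where
  "gen_eigenvector M lam k v \<longleftrightarrow>
     v \<in> carrier_vec (dim_row M) \<and>
     (char_matrix M lam ^\<^sub>m k) *\<^sub>v v = 0\<^sub>v (dim_row M) \<and>
     (char_matrix M lam ^\<^sub>m (k - 1)) *\<^sub>v v \<noteq> 0\<^sub>v (dim_row M)"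

(* Only x 0, ..., x r are constrained. *)
definition jordan_chain :: "complex mat \<Rightarrow> complex \<Rightarrow> nat \<Rightarrow> (nat \<Rightarrow> complex vec) \<Rightarrow> bool" where
  "jordan_chain A lam r x \<longleftrightarrow>
     x 0 = 0\<^sub>v (dim_row A) \<and>
     (\<forall>j\<in>{1..r}. gen_eigenvector A lam j (x j) \<and>
        A *\<^sub>v x j = lam \<cdot>\<^sub>v x j + x (j - 1))"

(* The chain belongs to the first block of the Jordan form with block list
   (r, lam) # bs: it consists of the columns for that block of a matrix P with
   A = P J P^{-1}.  The order of Jordan blocks being arbitrary, putting the block
   first loses no generality. *)
definition jordan_chain_of_first_block ::
  "complex mat \<Rightarrow> complex \<Rightarrow> nat \<Rightarrow> (nat \<times> complex) list \<Rightarrow> (nat \<Rightarrow> complex vec) \<Rightarrow> bool" where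
  "jordan_chain_of_first_block A lam r bs x \<longleftrightarrow>
     jordan_chain A lam r x \<and>
     (\<exists>P Q. similar_mat_wit A (jordan_matrix ((r, lam) # bs)) P Q \<and>
        (\<forall>j\<in>{1..r}. x j = col P (j - 1)))"

definition chain_beta :: "nat \<Rightarrow> complex vec \<Rightarrow> (nat \<Rightarrow> complex vec) \<Rightarrow> complex" where
  "chain_beta m b x = - hprod b (x 1) / (1 + hprod b (x (m + 1)))"

(* chain_coeff m b x t j is the j-th coefficient at level t.  The meaningful indices
   are 1 \<le> j \<le> t - 1 if t \<le> m + 1, and 1 \<le> j \<le> m if t > m + 1; the value is 0 for
   all other j. *)
fun chain_coeff ::
  "nat \<Rightarrow> complex vec \<Rightarrow> (nat \<Rightarrow> complex vec) \<Rightarrow> nat \<Rightarrow> nat \<Rightarrow> complex" where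
  "chain_coeff m b x t j =
    (if t < 2 \<or> j = 0 then 0
     else if t \<le> m + 1 then
       (if j = 1 then
          (- hprod b (x t)
           - (\<Sum>i = 2..t - 1. chain_coeff m b x (t - 1) (i - 1) * hprod b (x i))
           - chain_beta m b x * hprod b (x (m + t))) / hprod b (x 1)
        else if j \<le> t - 1 then chain_coeff m b x (t - 1) (j - 1)
        else 0)
     else
       (if j = 1 then
          (chain_coeff m b x (t - 1) m
           - hprod b (x t)
           - (\<Sum>i = 2..m. chain_coeff m b x (t - 1) (i - 1) * hprod b (x i))
           - chain_beta m b x * hprod b (x (m + t))) / hprod b (x 1)
        else if j \<le> m then chain_coeff m b x (t - 1) (j - 1)
        else 0))"

(* the unconditional equation loops as a rewrite rule *)
declare chain_coeff.simps [simp del]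

end

theory Submission
  imports Defs
begin

text \<open>
  Write $N = A - \lambda I$, so that $N x_j = x_{j-1}$, and $B = N + x_m b^*$.
  The choice of $\beta$ gives $B u_1 = 0$.  In $N u_t$ the shift of the coefficients
  reproduces $u_{t-1}$, except for a missing term $\beta_m^{(t-1)} x_m$; the recurrence for
  $\beta_1^{(t)}$ says exactly that $b^* u_t = \beta_m^{(t-1)}$, so the rank-one part of $B$
  restores that term.  Hence $B u_t = u_{t-1}$, and $B^{t-1} u_t = u_1$ is nonzero
  because $N u_1 = \beta x_m$.
\<close>

section \<open>Linearity over finite sums of vectors\<close>

lemma mult_mat_vec_finsum_vec:
  fixes M :: "'a :: field mat"
  assumes "M \<in> carrier_mat nr nc" "finite S" "f \<in> S \<rightarrow> carrier_vec nc"
  shows "M *\<^sub>v finsum_vec TYPE('a) nc f S = finsum_vec TYPE('a) nr (\<lambda>j. M *\<^sub>v f j) S"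
  using assms(2,3)
proof (induction S rule: finite_induct)
  case empty
  show ?case using assms(1) by (auto simp: finsum_vec_empty)
next
  case (insert a S)
  have f: "f \<in> S \<rightarrow> carrier_vec nc" "f a \<in> carrier_vec nc" using insert.prems by auto
  have Mf: "(\<lambda>j. M *\<^sub>v f j) \<in> S \<rightarrow> carrier_vec nr" "M *\<^sub>v f a \<in> carrier_vec nr"
    using f assms(1) by (auto intro!: mult_mat_vec_carrier)
  show ?case
    using insert.IH[OF f(1)]
    by (simp add: finsum_vec_insert[OF insert.hyps f] finsum_vec_insert[OF insert.hyps Mf]
        mult_add_distrib_mat_vec[OF assms(1) f(2) finsum_vec_closed[OF f(1)]])
qed

lemma scalar_prod_finsum_vec:
  fixes v :: "'a :: comm_ring_1 vec"
  assumes "v \<in> carrier_vec n" "finite S" "f \<in> S \<rightarrow> carrier_vec n"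
  shows "v \<bullet> finsum_vec TYPE('a) n f S = (\<Sum>j\<in>S. v \<bullet> f j)"
  using assms(2,3)
proof (induction S rule: finite_induct)
  case empty
  show ?case using assms(1) by (auto simp: finsum_vec_empty)
next
  case (insert a S)
  have f: "f \<in> S \<rightarrow> carrier_vec n" "f a \<in> carrier_vec n" using insert.prems by auto
  show ?case
    using insert.IH[OF f(1)] insert.hyps
    by (simp add: finsum_vec_insert[OF insert.hyps f]
        scalar_prod_add_distrib[OF assms(1) f(2) finsum_vec_closed[OF f(1)]])
qed

lemma mult_mat_zero_vec:
  assumes "M \<in> carrier_mat nr nc"
  shows "M *\<^sub>v 0\<^sub>v nc = (0\<^sub>v nr :: 'a :: semiring_0 vec)"
  using assms by (intro eq_vecI) auto

section \<open>Rank-one matrices and their effect on a shifted matrix\<close>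

lemma outer_hprod_carrier [simp]:
  assumes "y \<in> carrier_vec n" "b \<in> carrier_vec n"
  shows "outer_hprod y b \<in> carrier_mat n n"
  using assms unfolding outer_hprod_def by (intro mult_carrier_mat[of _ n 1 _ n]) (auto simp: carrier_matI)

lemma outer_hprod_mult_vec:
  assumes "y \<in> carrier_vec n" "b \<in> carrier_vec n" "v \<in> carrier_vec n"
  shows "outer_hprod y b *\<^sub>v v = hprod b v \<cdot>\<^sub>v y"
proof (rule eq_vecI)
  show "dim_vec (outer_hprod y b *\<^sub>v v) = dim_vec (hprod b v \<cdot>\<^sub>v y)"
    by (simp add: outer_hprod_def)
next
  fix i assume "i < dim_vec (hprod b v \<cdot>\<^sub>v y)"
  then show "(outer_hprod y b *\<^sub>v v) $ i = (hprod b v \<cdot>\<^sub>v y) $ i"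
    using assms
    by (auto simp: outer_hprod_def hprod_def scalar_prod_def mat_of_cols_def mat_of_rows_def
        sum_distrib_left ac_simps)
qed

lemma char_matrix_mult_vec:
  assumes "A \<in> carrier_mat n n" "v \<in> carrier_vec n"
  shows "char_matrix A lam *\<^sub>v v = A *\<^sub>v v - lam \<cdot>\<^sub>v v"
proof -
  have "char_matrix A lam *\<^sub>v v = A *\<^sub>v v + (- lam \<cdot>\<^sub>m 1\<^sub>m n) *\<^sub>v v"
    unfolding char_matrix_def using assms
    by (subst add_mult_distrib_mat_vec[of _ n n]) auto
  also have "(- lam \<cdot>\<^sub>m 1\<^sub>m n) *\<^sub>v v = - lam \<cdot>\<^sub>v v"
    using assms by (intro eq_vecI) auto
  finally show ?thesis using assms by auto
qed

text \<open>This is the splitting of B into N and a rank-one part: from here on, B need only be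
  understood through the vector N v and the scalar \<open>hprod b v\<close>.\<close>

lemma char_matrix_rank_one_update_mult_vec:
  assumes "A \<in> carrier_mat n n" "y \<in> carrier_vec n" "b \<in> carrier_vec n" "v \<in> carrier_vec n"
  shows "char_matrix (A + outer_hprod y b) lam *\<^sub>v v
    = char_matrix A lam *\<^sub>v v + hprod b v \<cdot>\<^sub>v y"
proof -
  have "(A + outer_hprod y b) *\<^sub>v v = A *\<^sub>v v + hprod b v \<cdot>\<^sub>v y"
    using assms by (simp add: add_mult_distrib_mat_vec[of _ n n] outer_hprod_mult_vec)
  moreover have "A + outer_hprod y b \<in> carrier_mat n n" using assms by simp
  ultimately show ?thesis
    using assms by (intro eq_vecI) (auto simp: char_matrix_mult_vec[of _ n])
qed

text \<open>Each factor \<open>char_matrix M lam\<close> moves one step down the chain, so t - 1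
  factors take \<open>u t\<close> to the nonzero vector \<open>u 1\<close>, and one further factor
  annihilates it.\<close>

lemma gen_eigenvector_of_chain:
  assumes M: "M \<in> carrier_mat n n"
    and u: "\<And>k. 1 \<le> k \<Longrightarrow> k \<le> t \<Longrightarrow> u k \<in> carrier_vec n"
    and step: "\<And>k. 1 \<le> k \<Longrightarrow> k < t \<Longrightarrow> char_matrix M lam *\<^sub>v u (Suc k) = u k"
    and bottom: "char_matrix M lam *\<^sub>v u 1 = 0\<^sub>v n" "u 1 \<noteq> 0\<^sub>v n"
    and t: "1 \<le> t"
  shows "gen_eigenvector M lam t (u t)"
proof -
  let ?C = "char_matrix M lam"
  have C: "?C \<in> carrier_mat n n" using M by simp
  have pow: "?C ^\<^sub>m k *\<^sub>v u (Suc k) = u 1" if "k < t" for k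
    using that
  proof (induction k)
    case 0
    then show ?case using u[of 1] t C by simp
  next
    case (Suc k)
    then have "?C ^\<^sub>m Suc k *\<^sub>v u (Suc (Suc k)) = ?C ^\<^sub>m k *\<^sub>v u (Suc k)"
      using C u[of "Suc (Suc k)"] step[of "Suc k"] by (simp add: assoc_mult_mat_vec[of _ n n _ n])
    then show ?case using Suc by simp
  qed
  obtain k where k: "t = Suc k" using t by (cases t) auto
  have low: "?C ^\<^sub>m k *\<^sub>v u t = u 1" using pow[of k] k by simp
  \<comment> \<open>Matrix powers add their new factor on the right, which suited the descent in
    \<open>pow\<close>. Killing \<open>u 1\<close> after the descent requires the last factor on the
    left.\<close>
  have "?C ^\<^sub>m t = ?C * ?C ^\<^sub>m k"
    unfolding k using C by (induction k) (simp_all add: assoc_mult_mat[of _ n n _ n _ n])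
  then have "?C ^\<^sub>m t *\<^sub>v u t = ?C *\<^sub>v (?C ^\<^sub>m k *\<^sub>v u t)"
    using C u[of t] t by (simp add: assoc_mult_mat_vec[of _ n n _ n])
  then show ?thesis
    using low bottom u[of t] t M k unfolding gen_eigenvector_def by auto
qed

section \<open>Uniform form of the recurrence for the coefficients\<close>

lemma chain_coeff_eq_0: "t \<le> j \<Longrightarrow> chain_coeff m b x t j = 0"
  by (subst chain_coeff.simps) auto

text \<open>For j < t both cases of the recurrence prescribe this shift. For j \<ge> t both sides
  are the default value 0, because then also j - 1 \<ge> t - 1. Hence the shift holds up to index m
  at every level from 2 on.\<close>

lemma chain_coeff_shift:
  assumes "2 \<le> t" "2 \<le> j" "j \<le> m"
  shows "chain_coeff m b x t j = chain_coeff m b x (t - 1) (j - 1)"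
proof (cases "j \<le> t - 1")
  case True
  then show ?thesis using assms by (subst chain_coeff.simps) auto
next
  case False
  then show ?thesis using assms chain_coeff_eq_0[of t j] chain_coeff_eq_0[of "t - 1" "j - 1"] by simp
qed

text \<open>
  Since the coefficients vanish for $j \ge t$, the second case of the recurrence is
  also valid when $t \le m + 1$.
\<close>

lemma chain_coeff_first:
  assumes "2 \<le> t" "1 \<le> m"
  shows "chain_coeff m b x t 1 =
    (chain_coeff m b x (t - 1) m - hprod b (x t)
     - (\<Sum>i = 2..m. chain_coeff m b x (t - 1) (i - 1) * hprod b (x i))
     - chain_beta m b x * hprod b (x (m + t))) / hprod b (x 1)"
proof (cases "t \<le> m + 1")
  case True
  \<comment> \<open>The added terms have i \<ge> t, so their coefficient index i - 1 is at least the
    level t - 1.\<close>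
  have "(\<Sum>i = 2..t - 1. chain_coeff m b x (t - 1) (i - 1) * hprod b (x i))
      = (\<Sum>i = 2..m. chain_coeff m b x (t - 1) (i - 1) * hprod b (x i))"
    using True by (intro sum.mono_neutral_left) (auto intro!: chain_coeff_eq_0)
  \<comment> \<open>The summand \<open>chain_coeff m b x (t - 1) m\<close>, present only in the
    second case, is 0 here since t - 1 \<le> m.\<close>
  then show ?thesis
    using assms True chain_coeff_eq_0[of "t - 1" m] by (subst chain_coeff.simps) auto
next
  case False
  then show ?thesis using assms by (subst chain_coeff.simps) auto
qed

text \<open>The vector u_t of the overview, in one formula for both cases. Summing up to m is
  correct for t \<le> m + 1 as well, as the coefficients with index at least t vanish; this avoids a
  case split in all calculations with u_t.\<close>

definition chain_vec ::
  "nat \<Rightarrow> nat \<Rightarrow> complex vec \<Rightarrow> (nat \<Rightarrow> complex vec) \<Rightarrow> nat \<Rightarrow> complex vec" where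
  "chain_vec n m b x t =
     x t + finsum_vec TYPE(complex) n (\<lambda>j. chain_coeff m b x t j \<cdot>\<^sub>v x j) {1..m}
       + chain_beta m b x \<cdot>\<^sub>v x (m + t)"

section \<open>Action of N and of b^* on the chain and on u_t\<close>

context
  fixes n m r :: nat and b :: "complex vec" and x :: "nat \<Rightarrow> complex vec"
    and A :: "complex mat" and lam :: complex
  assumes A: "A \<in> carrier_mat n n"
    and b: "b \<in> carrier_vec n"
    and chain: "jordan_chain A lam r x"
    and m: "1 \<le> m"
begin

text \<open>Index 0 is included, where the chain is the zero vector, because lowering indices
  produces \<open>x 0\<close>.\<close>

lemma chain_carrier: "j \<le> r \<Longrightarrow> x j \<in> carrier_vec n"
  using chain A unfolding jordan_chain_def gen_eigenvector_def by (cases "j = 0") auto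

lemma chain_dim: "j \<le> r \<Longrightarrow> dim_vec (x j) = n"
  using chain_carrier by auto

lemma chain_shift:
  assumes "1 \<le> j" "j \<le> r"
  shows "char_matrix A lam *\<^sub>v x j = x (j - 1)"
proof -
  have "A *\<^sub>v x j = lam \<cdot>\<^sub>v x j + x (j - 1)"
    using chain assms unfolding jordan_chain_def by simp
  then show ?thesis
    using A chain_carrier[of j] assms
    by (intro eq_vecI) (auto simp: char_matrix_mult_vec[of _ n] chain_dim)
qed

lemma chain_nonzero:
  assumes "1 \<le> j" "j \<le> r"
  shows "x j \<noteq> 0\<^sub>v n"
proof
  assume "x j = 0\<^sub>v n"
  moreover have "char_matrix A lam ^\<^sub>m (j - 1) *\<^sub>v x j \<noteq> 0\<^sub>v n"
    using chain assms A unfolding jordan_chain_def gen_eigenvector_def by auto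
  moreover have "char_matrix A lam ^\<^sub>m (j - 1) \<in> carrier_mat n n" using A by simp
  ultimately show False by (metis mult_mat_zero_vec)
qed

lemma chain_term_carrier:
  "m \<le> r \<Longrightarrow> (\<lambda>j. chain_coeff m b x t j \<cdot>\<^sub>v x j) \<in> {1..m} \<rightarrow> carrier_vec n"
  using chain_carrier by auto

lemma chain_vec_carrier: "m + t \<le> r \<Longrightarrow> chain_vec n m b x t \<in> carrier_vec n"
  unfolding chain_vec_def
  using chain_carrier
  by (intro add_carrier_vec finsum_vec_closed[OF chain_term_carrier] smult_carrier_vec[THEN iffD2]) auto

lemma hprod_chain_vec:
  assumes "m + t \<le> r"
  shows "hprod b (chain_vec n m b x t)
    = hprod b (x t) + (\<Sum>j = 1..m. chain_coeff m b x t j * hprod b (x j))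
      + chain_beta m b x * hprod b (x (m + t))"
proof -
  have F: "finsum_vec TYPE(complex) n (\<lambda>j. chain_coeff m b x t j \<cdot>\<^sub>v x j) {1..m} \<in> carrier_vec n"
    using assms by (intro finsum_vec_closed chain_term_carrier) auto
  have b': "conjugate b \<in> carrier_vec n" using b by simp
  have "conjugate b \<bullet> finsum_vec TYPE(complex) n (\<lambda>j. chain_coeff m b x t j \<cdot>\<^sub>v x j) {1..m}
     = (\<Sum>j = 1..m. conjugate b \<bullet> (chain_coeff m b x t j \<cdot>\<^sub>v x j))"
    using assms by (intro scalar_prod_finsum_vec[OF b'] chain_term_carrier) auto
  also have "\<dots> = (\<Sum>j = 1..m. chain_coeff m b x t j * (conjugate b \<bullet> x j))"
    using assms b' chain_carrier
    by (intro sum.cong refl scalar_prod_smult_distrib[of _ n]) auto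
  finally show ?thesis
    using assms F b' chain_carrier[of t] chain_carrier[of "m + t"]
    unfolding chain_vec_def hprod_def
    by (simp add: scalar_prod_add_distrib[OF b'] scalar_prod_smult_distrib[OF b'])
qed

text \<open>N lowers every chain index by one and leaves the coefficients at level t; passing to
  level t - 1 is done in \<open>rank_one_update_chain_vec\<close>.\<close>

lemma char_matrix_chain_vec:
  assumes "1 \<le> t" "m + t \<le> r"
  shows "char_matrix A lam *\<^sub>v chain_vec n m b x t
    = x (t - 1) + finsum_vec TYPE(complex) n (\<lambda>j. chain_coeff m b x t j \<cdot>\<^sub>v x (j - 1)) {1..m}
      + chain_beta m b x \<cdot>\<^sub>v x (m + t - 1)"
proof -
  let ?F = "finsum_vec TYPE(complex) n (\<lambda>j. chain_coeff m b x t j \<cdot>\<^sub>v x j) {1..m}"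
  let ?G = "finsum_vec TYPE(complex) n (\<lambda>j. chain_coeff m b x t j \<cdot>\<^sub>v x (j - 1)) {1..m}"
  let ?C = "char_matrix A lam"
  have C: "?C \<in> carrier_mat n n" using A by simp
  have F: "?F \<in> carrier_vec n"
    using assms by (intro finsum_vec_closed chain_term_carrier) auto
  have xt: "x t \<in> carrier_vec n" "x (m + t) \<in> carrier_vec n" using assms chain_carrier by auto
  have "?C *\<^sub>v ?F = finsum_vec TYPE(complex) n (\<lambda>j. ?C *\<^sub>v (chain_coeff m b x t j \<cdot>\<^sub>v x j)) {1..m}"
    using assms by (intro mult_mat_vec_finsum_vec[OF C] chain_term_carrier) auto
  also have "\<dots> = ?G"
  proof (rule eq_vecI)
    have c1: "(\<lambda>j. ?C *\<^sub>v (chain_coeff m b x t j \<cdot>\<^sub>v x j)) \<in> {1..m} \<rightarrow> carrier_vec n"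
      using assms chain_carrier C by (auto intro!: mult_mat_vec_carrier)
    have c2: "(\<lambda>j. chain_coeff m b x t j \<cdot>\<^sub>v x (j - 1)) \<in> {1..m} \<rightarrow> carrier_vec n"
      using assms chain_carrier by auto
    show "dim_vec (finsum_vec TYPE(complex) n (\<lambda>j. ?C *\<^sub>v (chain_coeff m b x t j \<cdot>\<^sub>v x j)) {1..m})
        = dim_vec ?G"
      using finsum_vec_closed[OF c1] finsum_vec_closed[OF c2] by simp
    fix i assume "i < dim_vec ?G"
    then have i: "i < n" using finsum_vec_closed[OF c2] by simp
    have eq: "?C *\<^sub>v (chain_coeff m b x t j \<cdot>\<^sub>v x j) = chain_coeff m b x t j \<cdot>\<^sub>v x (j - 1)"
      if "j \<in> {1..m}" for j
      using that assms chain_carrier[of j] chain_shift[of j] by (simp add: mult_mat_vec[OF C])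
    show "finsum_vec TYPE(complex) n (\<lambda>j. ?C *\<^sub>v (chain_coeff m b x t j \<cdot>\<^sub>v x j)) {1..m} $ i = ?G $ i"
      unfolding index_finsum_vec[OF finite_atLeastAtMost i c1]
        index_finsum_vec[OF finite_atLeastAtMost i c2]
      by (rule sum.cong[OF refl]) (simp add: eq)
  qed
  finally have "?C *\<^sub>v ?F = ?G" .
  moreover have "?C *\<^sub>v (x t + ?F + chain_beta m b x \<cdot>\<^sub>v x (m + t))
      = ?C *\<^sub>v x t + ?C *\<^sub>v ?F + chain_beta m b x \<cdot>\<^sub>v (?C *\<^sub>v x (m + t))"
    using F xt
    by (simp del: assoc_add_vec add: mult_add_distrib_mat_vec[OF C] mult_mat_vec[OF C])
  ultimately show ?thesis
    using chain_shift[of t] chain_shift[of "m + t"] assms unfolding chain_vec_def by simp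
qed

section \<open>The bottom vector u_1\<close>

lemma chain_vec_1:
  assumes "m + 1 \<le> r"
  shows "chain_vec n m b x 1 = x 1 + chain_beta m b x \<cdot>\<^sub>v x (m + 1)"
proof (rule eq_vecI)
  have car: "x 1 \<in> carrier_vec n" "x (m + 1) \<in> carrier_vec n" using assms chain_carrier by auto
  show "dim_vec (chain_vec n m b x 1) = dim_vec (x 1 + chain_beta m b x \<cdot>\<^sub>v x (m + 1))"
    using car chain_vec_carrier[of 1] assms by auto
  fix i assume "i < dim_vec (x 1 + chain_beta m b x \<cdot>\<^sub>v x (m + 1))"
  then have i: "i < n" using car by simp
  have tc: "(\<lambda>j. chain_coeff m b x 1 j \<cdot>\<^sub>v x j) \<in> {1..m} \<rightarrow> carrier_vec n"
    using assms by (intro chain_term_carrier) auto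
  have "(\<Sum>j = 1..m. (chain_coeff m b x 1 j \<cdot>\<^sub>v x j) $ i) = 0"
    using assms i by (intro sum.neutral) (auto simp: chain_coeff_eq_0 chain_dim)
  then show "chain_vec n m b x 1 $ i = (x 1 + chain_beta m b x \<cdot>\<^sub>v x (m + 1)) $ i"
    using car i finsum_vec_closed[OF tc] index_finsum_vec[OF finite_atLeastAtMost i tc]
    unfolding chain_vec_def by auto
qed

lemma char_matrix_chain_vec_1:
  assumes "m + 1 \<le> r"
  shows "char_matrix A lam *\<^sub>v chain_vec n m b x 1 = chain_beta m b x \<cdot>\<^sub>v x m"
proof -
  have C: "char_matrix A lam \<in> carrier_mat n n" using A by simp
  have "x 0 = 0\<^sub>v n" using chain A unfolding jordan_chain_def by auto
  then show ?thesis
    using assms chain_carrier[of 1] chain_carrier[of m] chain_carrier[of "m + 1"]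
      chain_shift[of 1] chain_shift[of "m + 1"]
    unfolding chain_vec_1[OF assms]
    by (simp add: mult_add_distrib_mat_vec[OF C] mult_mat_vec[OF C])
qed

text \<open>If u_1 were 0, then N u_1 = \<beta> x_m would be 0, so \<beta> = 0 because x_m is
  nonzero. But then u_1 is just x_1, which is nonzero.\<close>

lemma chain_vec_1_nonzero:
  assumes "m + 1 \<le> r"
  shows "chain_vec n m b x 1 \<noteq> 0\<^sub>v n"
proof
  assume z: "chain_vec n m b x 1 = 0\<^sub>v n"
  have C: "char_matrix A lam \<in> carrier_mat n n" using A by simp
  have "chain_beta m b x \<cdot>\<^sub>v x m = 0\<^sub>v n"
    using char_matrix_chain_vec_1[OF assms] mult_mat_zero_vec[OF C] z by simp
  moreover obtain i where i: "i < n" "x m $ i \<noteq> 0"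
    using chain_nonzero[of m] chain_carrier[of m] m assms by (auto simp: vec_eq_iff)
  ultimately have "(chain_beta m b x \<cdot>\<^sub>v x m) $ i = 0" by simp
  then have "chain_beta m b x = 0"
    using i chain_carrier[of m] assms by simp
  then have "x 1 = 0\<^sub>v n"
    using z chain_carrier[of 1] assms unfolding chain_vec_1[OF assms]
    by (auto simp: vec_eq_iff chain_dim)
  then show False using chain_nonzero[of 1] assms by simp
qed

text \<open>This is where the value of \<beta> comes from. Since N u_1 = \<beta> x_m, the rank-one
  part cancels it if b^* u_1 = -\<beta>, that is b^* x_1 + \<beta> b^* x_{m+1} = -\<beta>, and
  \<open>chain_beta\<close> solves this linear equation.\<close>

lemma rank_one_update_chain_vec_1:
  assumes "m + 1 \<le> r" "1 + hprod b (x (m + 1)) \<noteq> 0"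
  shows "char_matrix (A + outer_hprod (x m) b) lam *\<^sub>v chain_vec n m b x 1 = 0\<^sub>v n"
proof -
  have "hprod b (chain_vec n m b x 1)
      = hprod b (x 1) + chain_beta m b x * hprod b (x (m + 1))"
    using hprod_chain_vec[of 1] assms by (simp add: chain_coeff_eq_0)
  also have "\<dots> = - chain_beta m b x"
    using assms(2) unfolding chain_beta_def by (simp add: field_simps)
  finally show ?thesis
    using assms A b chain_carrier[of m] chain_vec_carrier[of 1] char_matrix_chain_vec_1
    by (auto simp: char_matrix_rank_one_update_mult_vec)
qed

text \<open>The rank-one part contributes (b^* u_t) x_m. The first coefficient is chosen to make
  this scalar the m-th coefficient of level t - 1, the only one that the shift by N cannot
  produce.\<close>

lemma rank_one_update_chain_vec:
  assumes t: "2 \<le> t" "m + t \<le> r" and bx1: "hprod b (x 1) \<noteq> 0"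
  shows "char_matrix (A + outer_hprod (x m) b) lam *\<^sub>v chain_vec n m b x t
    = chain_vec n m b x (t - 1)"
proof -
  let ?c = "chain_coeff m b x"
  let ?h = "\<lambda>j. hprod b (x j)"
  let ?\<beta> = "chain_beta m b x"
  have split: "(\<Sum>j = 1..m. f j) = f 1 + (\<Sum>j = 2..m. f j)" for f :: "nat \<Rightarrow> complex"
    using m by (simp add: sum.atLeast_Suc_atMost numeral_2_eq_2)
  \<comment> \<open>The recurrence for the first coefficient, cleared of its denominator b^* x_1,
    becomes a linear equation for b^* u_t.\<close>
  have "?c t 1 * ?h 1 =
      ?c (t - 1) m - ?h t - (\<Sum>i = 2..m. ?c (t - 1) (i - 1) * ?h i) - ?\<beta> * ?h (m + t)"
    using chain_coeff_first[OF t(1) m] bx1 by simp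
  moreover have "(\<Sum>i = 2..m. ?c (t - 1) (i - 1) * ?h i) = (\<Sum>i = 2..m. ?c t i * ?h i)"
    using t by (intro sum.cong) (auto simp: chain_coeff_shift)
  \<comment> \<open>In the expansion of b^* u_t everything cancels against
    \<open>?c t 1 * ?h 1\<close> except this coefficient.\<close>
  ultimately have h: "hprod b (chain_vec n m b x t) = ?c (t - 1) m"
    using hprod_chain_vec[OF t(2)] split[of "\<lambda>j. ?c t j * ?h j"] by simp
  have c1: "(\<lambda>j. ?c t j \<cdot>\<^sub>v x (j - 1)) \<in> {1..m} \<rightarrow> carrier_vec n"
    using t chain_carrier by auto
  have c2: "(\<lambda>j. ?c (t - 1) j \<cdot>\<^sub>v x j) \<in> {1..m} \<rightarrow> carrier_vec n"
    using t chain_carrier by auto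
  have car: "x (t - 1) \<in> carrier_vec n" "x m \<in> carrier_vec n" "x (m + t - 1) \<in> carrier_vec n"
    using t chain_carrier by auto
  \<comment> \<open>The lowered sum gives the terms 1 to m - 1 of the sum at level t - 1, and the
    rank-one part supplies term m.\<close>
  have shift: "finsum_vec TYPE(complex) n (\<lambda>j. ?c t j \<cdot>\<^sub>v x (j - 1)) {1..m} + ?c (t - 1) m \<cdot>\<^sub>v x m
      = finsum_vec TYPE(complex) n (\<lambda>j. ?c (t - 1) j \<cdot>\<^sub>v x j) {1..m}" (is "?L = ?R")
  proof (rule eq_vecI)
    show "dim_vec ?L = dim_vec ?R" using finsum_vec_closed[OF c2] car by auto
    fix i assume "i < dim_vec ?R"
    then have i: "i < n" using finsum_vec_closed[OF c2] by simp
    have "(\<Sum>j = 1..m. (?c t j \<cdot>\<^sub>v x (j - 1)) $ i) = (\<Sum>j = 1..m. ?c t j * x (j - 1) $ i)"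
      using t i by (intro sum.cong) (auto simp: chain_dim)
    \<comment> \<open>The term j = 1 drops out because \<open>x 0\<close> is the zero vector, so the
      value of the first coefficient does not enter the lowered sum.\<close>
    also have "\<dots> = (\<Sum>j = 2..m. ?c t j * x (j - 1) $ i)"
      unfolding split using chain A i unfolding jordan_chain_def by simp
    also have "\<dots> = (\<Sum>j = 2..m. ?c (t - 1) (j - 1) * x (j - 1) $ i)"
      using t by (intro sum.cong) (auto simp: chain_coeff_shift)
    also have "\<dots> = (\<Sum>j = 1..m - 1. ?c (t - 1) j * x j $ i)"
      by (rule sum.reindex_bij_witness[of _ "\<lambda>j. j + 1" "\<lambda>j. j - 1"]) auto
    also have "\<dots> + ?c (t - 1) m * x m $ i = (\<Sum>j = 1..m. ?c (t - 1) j * x j $ i)"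
      using m by (cases m) auto
    also have "\<dots> = (\<Sum>j = 1..m. (?c (t - 1) j \<cdot>\<^sub>v x j) $ i)"
      using t i by (intro sum.cong) (auto simp: chain_dim)
    finally show "?L $ i = ?R $ i"
      using i car finsum_vec_closed[OF c1] index_finsum_vec[OF finite_atLeastAtMost i c1]
        index_finsum_vec[OF finite_atLeastAtMost i c2]
      by auto
  qed
  have "char_matrix (A + outer_hprod (x m) b) lam *\<^sub>v chain_vec n m b x t
      = char_matrix A lam *\<^sub>v chain_vec n m b x t + ?c (t - 1) m \<cdot>\<^sub>v x m"
    using char_matrix_rank_one_update_mult_vec[OF A car(2) b chain_vec_carrier[OF t(2)]] h by simp
  also have "\<dots> = x (t - 1) + ?R + ?\<beta> \<cdot>\<^sub>v x (m + t - 1)"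
  proof -
    \<comment> \<open>The rank-one contribution w is moved next to the lowered sum g so that
      \<open>shift\<close> can absorb it.\<close>
    have swap: "p + g + q + w = p + (g + w) + q"
      if "p \<in> carrier_vec n" "g \<in> carrier_vec n" "q \<in> carrier_vec n" "w \<in> carrier_vec n"
      for p g q w :: "complex vec"
      using that by (intro eq_vecI) auto
    have "char_matrix A lam *\<^sub>v chain_vec n m b x t
        = x (t - 1) + finsum_vec TYPE(complex) n (\<lambda>j. ?c t j \<cdot>\<^sub>v x (j - 1)) {1..m}
          + ?\<beta> \<cdot>\<^sub>v x (m + t - 1)"
      using t by (intro char_matrix_chain_vec) auto
    then show ?thesis
      using car finsum_vec_closed[OF c1] by (simp only: swap smult_carrier_vec flip: shift)
  qed
  also have "\<dots> = chain_vec n m b x (t - 1)"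
    using t unfolding chain_vec_def by simp
  finally show ?thesis .
qed

section \<open>Rank of u_t, and the two forms of its formula\<close>

lemma gen_eigenvector_chain_vec:
  assumes "1 \<le> t" "m + t \<le> r"
    and "1 + hprod b (x (m + 1)) \<noteq> 0"
    and "2 \<le> t \<Longrightarrow> hprod b (x 1) \<noteq> 0"
  shows "gen_eigenvector (A + outer_hprod (x m) b) lam t (chain_vec n m b x t)"
proof (rule gen_eigenvector_of_chain[where n = n])
  show "A + outer_hprod (x m) b \<in> carrier_mat n n"
    using A b chain_carrier[of m] assms by simp
  \<comment> \<open>Having 1 \<le> k < t forces t \<ge> 2, so b^* x_1 is known to be nonzero
    whenever a step of the chain has to be made.\<close>
  show "char_matrix (A + outer_hprod (x m) b) lam *\<^sub>v chain_vec n m b x (Suc k) = chain_vec n m b x k"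
    if "1 \<le> k" "k < t" for k
    using rank_one_update_chain_vec[of "Suc k"] that assms by simp
qed (use assms chain_vec_carrier rank_one_update_chain_vec_1 chain_vec_1_nonzero in auto)

text \<open>Returns from the uniform formula to case (1): the terms from t to m have zero
  coefficients.\<close>

lemma chain_vec_truncated:
  assumes "t \<le> m + 1" "m + t \<le> r"
  shows "chain_vec n m b x t =
    x t + finsum_vec TYPE(complex) n (\<lambda>j. chain_coeff m b x t j \<cdot>\<^sub>v x j) {1..t - 1}
      + chain_beta m b x \<cdot>\<^sub>v x (m + t)"
proof -
  let ?f = "\<lambda>j. chain_coeff m b x t j \<cdot>\<^sub>v x j"
  have c1: "?f \<in> {1..m} \<rightarrow> carrier_vec n" using assms by (intro chain_term_carrier) auto
  have c2: "?f \<in> {1..t - 1} \<rightarrow> carrier_vec n" using c1 assms by auto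
  have "finsum_vec TYPE(complex) n ?f {1..m} = finsum_vec TYPE(complex) n ?f {1..t - 1}"
  proof (rule eq_vecI)
    show "dim_vec (finsum_vec TYPE(complex) n ?f {1..m})
        = dim_vec (finsum_vec TYPE(complex) n ?f {1..t - 1})"
      using finsum_vec_closed[OF c1] finsum_vec_closed[OF c2] by simp
    fix i assume "i < dim_vec (finsum_vec TYPE(complex) n ?f {1..t - 1})"
    then have i: "i < n" using finsum_vec_closed[OF c2] by simp
    have "(\<Sum>j = 1..m. ?f j $ i) = (\<Sum>j = 1..t - 1. ?f j $ i)"
      using assms i
      by (intro sum.mono_neutral_right) (auto simp: chain_coeff_eq_0 chain_dim)
    then show "finsum_vec TYPE(complex) n ?f {1..m} $ i
        = finsum_vec TYPE(complex) n ?f {1..t - 1} $ i"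
      by (simp only: index_finsum_vec[OF finite_atLeastAtMost i c1]
          index_finsum_vec[OF finite_atLeastAtMost i c2])
  qed
  then show ?thesis unfolding chain_vec_def by simp
qed

end

theorem theorem3p4:
  fixes A :: "complex mat" and b :: "complex vec" and x :: "nat \<Rightarrow> complex vec"
    and lam :: complex and n r r' m t :: nat
    and bs bs' :: "(nat \<times> complex) list"
  assumes A: "A \<in> carrier_mat n n"
    and eigenvalue: "eigenvalue A lam"
    and block: "jordan_nf A ((r, lam) # bs)"
    and chain: "jordan_chain_of_first_block A lam r bs x"
    and m: "1 \<le> m" "m \<le> r"
    and b: "b \<in> carrier_vec n"
    and new_block: "jordan_nf (A + outer_hprod (x m) b) ((r', lam) # bs')"
    and t: "1 \<le> t" "t \<le> r'" "m + t \<le> r"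
    and denom: "1 + hprod b (x (m + 1)) \<noteq> 0"
    and bx1: "2 \<le> t \<Longrightarrow> hprod b (x 1) \<noteq> 0"
  shows "(t \<le> m + 1 \<longrightarrow>
      gen_eigenvector (A + outer_hprod (x m) b) lam t
        (x t + finsum_vec TYPE(complex) n (\<lambda>j. chain_coeff m b x t j \<cdot>\<^sub>v x j) {1..t - 1}
         + chain_beta m b x \<cdot>\<^sub>v x (m + t)))
    \<and> (t > m + 1 \<longrightarrow>
      gen_eigenvector (A + outer_hprod (x m) b) lam t
        (x t + finsum_vec TYPE(complex) n (\<lambda>j. chain_coeff m b x t j \<cdot>\<^sub>v x j) {1..m}
         + chain_beta m b x \<cdot>\<^sub>v x (m + t)))"
proof -
  have jc: "jordan_chain A lam r x"
    using chain unfolding jordan_chain_of_first_block_def by simp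
  have "gen_eigenvector (A + outer_hprod (x m) b) lam t (chain_vec n m b x t)"
    using gen_eigenvector_chain_vec[OF A b jc m(1) t(1,3) denom bx1] .
  \<comment> \<open>Case (2) is the defining formula of \<open>chain_vec\<close>; case (1) is its
    truncated form.\<close>
  then show ?thesis
    using chain_vec_truncated[OF A b jc m(1) _ t(3)] unfolding chain_vec_def by auto
qed

end
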